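(* Let $n\ge 1$ and let $a_1,\ldots,a_n$ be integers with $a_i \ge i$ for all $i=1,\ldots,n$. Then the simplicial complex $\Sigma(\Psi_{a_n,\ldots,a_1})$ of non-attacking rook placements on the triangular board $\Psi_{a_n,\ldots,a_1}$ is vertex decomposable.
   Context: For positive integers $a_1,\ldots,a_n$, the triangular board $\Psi_{a_n,\ldots,a_1}$ is the left-justified board with $a_i$ rows of length $i$ for each $1\le i\le n$ (the Ferrers board of the partition $(n^{a_n},\ldots,1^{a_1})$). Its $p=\sum_{i=1}^n a_i$ rows are numbered $1,\ldots,p$ from bottom to top, with row lengths weakly increasing from bottom to top; columns are numbered from left to right, and square $(i,j)$ is the one in column $i$ and row $j$. A non-attacking rook placement is a set of squares of the board, no two in the same row and no two in the same column. $\Sigma(\Psi_{a_n,\ldots,a_1})$ is the simplicial complex whose vertices are the squares and whose faces are the non-attacking rook placements (including the empty one). For a simplicial complex $\Delta$ and a vertex $x$: $\operatorname{lk}_\Delta(x)=\{\tau\in\Delta : x\notin\tau,\ \tau\cup\{x\}\in\Delta\}$ and $\operatorname{del}_\Delta(x)=\{\tau\in\Delta : x\notin\tau\}$. Vertex decomposability is defined recursively: (1) every simplex (including $\emptyset$ and $\{\emptyset\}$) is vertex decomposable; (2) $\Delta$ is vertex decomposable if $\Delta$ is pure (all facets have the same dimension) and contains a vertex $x$ such that $\operatorname{del}_\Delta(x)$ and $\operatorname{lk}_\Delta(x)$ are both vertex decomposable. *)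

theory Defs
  imports Main
begin

text \<open>A simplicial complex is represented by its set of faces. Both the void complex
  \<open>{}\<close> and the complex \<open>{{}}\<close> are allowed.\<close>

definition simplicial_complex :: "'a set set \<Rightarrow> bool" where
  "simplicial_complex D \<longleftrightarrow> (\<forall>F\<in>D. finite F \<and> (\<forall>G. G \<subseteq> F \<longrightarrow> G \<in> D))"

definition facets :: "'a set set \<Rightarrow> 'a set set" where
  "facets D = {F \<in> D. \<forall>G\<in>D. F \<subseteq> G \<longrightarrow> G = F}"

definition face_dim :: "'a set \<Rightarrow> int" where
  "face_dim F = int (card F) - 1"

definition pure_complex :: "'a set set \<Rightarrow> bool" where
  "pure_complex D \<longleftrightarrow> (\<forall>F\<in>facets D. \<forall>G\<in>facets D. face_dim F = face_dim G)"

definition link :: "'a set set \<Rightarrow> 'a \<Rightarrow> 'a set set" where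
  "link D x = {F \<in> D. x \<notin> F \<and> F \<union> {x} \<in> D}"

definition deletion :: "'a set set \<Rightarrow> 'a \<Rightarrow> 'a set set" where
  "deletion D x = {F \<in> D. x \<notin> F}"

text \<open>The simplex on the vertex set \<open>V\<close> is \<open>Pow V\<close>; the case \<open>V = {}\<close> gives \<open>{{}}\<close>.
  In the last rule \<open>{x} \<in> D\<close> says that \<open>x\<close> is a vertex of \<open>D\<close>.\<close>

inductive vertex_decomposable :: "'a set set \<Rightarrow> bool" where
  void: "vertex_decomposable {}"
| simplex: "finite V \<Longrightarrow> vertex_decomposable (Pow V)"
| shed: "\<lbrakk>simplicial_complex D; pure_complex D; {x} \<in> D;
          vertex_decomposable (deletion D x); vertex_decomposable (link D x)\<rbrakk>
         \<Longrightarrow> vertex_decomposable D"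

text \<open>Row lengths of the triangular board, listed from the bottom row to the top row:
  \<open>a 1\<close> rows of length 1, followed by \<open>a 2\<close> rows of length 2, and so on up to
  \<open>a n\<close> rows of length \<open>n\<close>.\<close>

definition triangular_rows :: "nat \<Rightarrow> (nat \<Rightarrow> nat) \<Rightarrow> nat list" where
  "triangular_rows n a = concat (map (\<lambda>i. replicate (a i) i) [1..<n + 1])"

text \<open>A square \<open>(i, j)\<close> lies in column \<open>i\<close> and row \<open>j\<close>, both numbered from 1, whereas list
  positions start at 0.\<close>

definition triangular_board :: "nat \<Rightarrow> (nat \<Rightarrow> nat) \<Rightarrow> (nat \<times> nat) set" where
  "triangular_board n a =
     {(i, j). 1 \<le> j \<and> j \<le> length (triangular_rows n a) \<and>
              1 \<le> i \<and> i \<le> triangular_rows n a ! (j - 1)}"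

definition non_attacking :: "(nat \<times> nat) set \<Rightarrow> bool" where
  "non_attacking R \<longleftrightarrow>
     (\<forall>s\<in>R. \<forall>t\<in>R. s \<noteq> t \<longrightarrow> fst s \<noteq> fst t \<and> snd s \<noteq> snd t)"

definition rook_complex :: "(nat \<times> nat) set \<Rightarrow> (nat \<times> nat) set set" where
  "rook_complex B = {R. R \<subseteq> B \<and> non_attacking R}"

end

theory Submission
  imports Defs
begin

text \<open>Only two facts about the board matter: the rightmost of the \<open>n\<close> columns has at least \<open>n\<close>
  squares, and every other column has at least \<open>a n + a (n - 1) \<ge> 2 * n - 1\<close> squares. Any board
  with such column sizes, whatever its shape, is shed as follows. Let \<open>c\<close> be the small column and
  \<open>(c, r)\<close> one of its squares. First shed the other squares of row \<open>r\<close>, then the other squares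
  of column \<open>c\<close>, and finally \<open>(c, r)\<close> itself, which by then is a cone point. Each link is the
  complex of a board with one column less, where every column has lost at most two squares, and at
  most one if \<open>c\<close> is still present, so induction on the number of columns applies. All
  intermediate complexes are pure because a placement that misses a column can be extended there.\<close>

section \<open>Columns of a board and the effect of striking a square\<close>

definition column :: "(nat \<times> nat) set \<Rightarrow> nat \<Rightarrow> nat set" where
  "column B i = {r. (i, r) \<in> B}"

text \<open>The squares that survive a rook placed on \<open>x\<close>: its row and column go, and
  \<open>x\<close> with them. This is the board behind the link of \<open>x\<close>.\<close>

definition strike :: "(nat \<times> nat) set \<Rightarrow> nat \<times> nat \<Rightarrow> (nat \<times> nat) set" where
  "strike B x = {y \<in> B. fst y \<noteq> fst x \<and> snd y \<noteq> snd x}"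

lemma finite_column: "finite B \<Longrightarrow> finite (column B i)"
  by (rule finite_subset[of _ "snd ` B"]) (force simp: column_def)+

lemma finite_strike: "finite B \<Longrightarrow> finite (strike B x)"
  by (simp add: strike_def)

lemma column_strike: "i \<noteq> fst x \<Longrightarrow> column (strike B x) i = column B i - {snd x}"
  by (auto simp: column_def strike_def)

lemma column_remove:
  "column (B - {x}) i = (if i = fst x then column B i - {snd x} else column B i)"
  by (cases x) (auto simp: column_def)

lemma card_Diff_singleton_ge: "card A \<le> Suc (card (A - {x}))"
  by (cases "finite A"; cases "x \<in> A"; simp add: card_Diff_singleton_if)

section \<open>Deletions and links of rook complexes\<close>

lemma deletion_rook: "deletion (rook_complex B) x = rook_complex (B - {x})"
  by (auto simp: deletion_def rook_complex_def)

lemma non_attacking_insert: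
  assumes "x \<notin> F"
  shows "non_attacking (insert x F) \<longleftrightarrow>
    non_attacking F \<and> (\<forall>y\<in>F. fst y \<noteq> fst x \<and> snd y \<noteq> snd x)"
proof -
  have "y \<noteq> x" "x \<noteq> y" if "y \<in> F" for y using assms that by blast+
  then show ?thesis
    \<comment> \<open>\<open>non_attacking\<close> ranges over ordered pairs, so each condition
      between \<open>x\<close> and a square of \<open>F\<close> occurs in both orientations;
      orienting the equations identifies them.\<close>
    by (simp add: non_attacking_def ball_conj_distrib cong: ball_cong)
      (simp only: eq_commute[of "fst x"] eq_commute[of "snd x"], blast)
qed

text \<open>A placement tolerates a further rook on \<open>x\<close> exactly when it avoids the row
  and the column of \<open>x\<close>, and avoiding them already gives
  \<open>x \<notin> F\<close>.\<close>

lemma link_rook: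
  assumes "x \<in> B"
  shows "link (rook_complex B) x = rook_complex (strike B x)"
proof (rule set_eqI)
  fix F
  have "F \<in> rook_complex (strike B x) \<longleftrightarrow>
      F \<subseteq> B \<and> non_attacking F \<and> (\<forall>y\<in>F. fst y \<noteq> fst x \<and> snd y \<noteq> snd x)"
    unfolding rook_complex_def strike_def by blast
  moreover have "F \<in> link (rook_complex B) x \<longleftrightarrow>
      F \<subseteq> B \<and> non_attacking F \<and> x \<notin> F \<and> non_attacking (insert x F)"
    using assms by (simp add: link_def rook_complex_def) blast
  ultimately show "F \<in> link (rook_complex B) x \<longleftrightarrow> F \<in> rook_complex (strike B x)"
    using non_attacking_insert[of x F] by blast
qed

section \<open>Purity and the shedding rule on boards\<close>

lemma simplicial_complex_rook:
  assumes "finite B"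
  shows "simplicial_complex (rook_complex B)"
  unfolding simplicial_complex_def
proof (intro ballI conjI allI impI)
  fix F G
  assume "F \<in> rook_complex B"
  then have "F \<subseteq> B" "non_attacking F" by (simp_all add: rook_complex_def)
  show "finite F" using \<open>F \<subseteq> B\<close> assms by (rule finite_subset)
  assume "G \<subseteq> F"
  with \<open>non_attacking F\<close> have "non_attacking G"
    unfolding non_attacking_def by blast
  with \<open>G \<subseteq> F\<close> \<open>F \<subseteq> B\<close> show "G \<in> rook_complex B"
    unfolding rook_complex_def by blast
qed

text \<open>A facet has at most one rook per column. If it missed a column \<open>i\<close> of
  \<open>K\<close>, it would occupy fewer than \<open>card K\<close> rows, so a column with
  \<open>card K\<close> squares has one in a free row. A square alone in its row is free as well,
  since only a rook in column \<open>i\<close> could use that row. Either way the facet could be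
  extended. The second alternative serves a column that has been shrunk below \<open>card K\<close>
  squares.\<close>

lemma card_facet_rook:
  assumes "finite B" "finite K" "fst ` B \<subseteq> K"
    and ext: "\<And>i. i \<in> K \<Longrightarrow> card K \<le> card (column B i) \<or>
               (\<exists>r. (i, r) \<in> B \<and> (\<forall>j. (j, r) \<in> B \<longrightarrow> j = i))"
    and F: "F \<in> facets (rook_complex B)"
  shows "card F = card K"
proof -
  have FB: "F \<subseteq> B" and na: "non_attacking F"
    and mx: "\<And>G. G \<subseteq> B \<Longrightarrow> non_attacking G \<Longrightarrow> F \<subseteq> G \<Longrightarrow> G = F"
    using F by (auto simp: facets_def rook_complex_def)
  have fin: "finite F" using FB assms(1) by (rule finite_subset)
  have inj: "inj_on fst F" using na unfolding inj_on_def non_attacking_def by blast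
  have sub: "fst ` F \<subseteq> K" using FB assms(3) by blast
  have "i \<in> fst ` F" if i: "i \<in> K" for i
  proof (rule ccontr)
    assume ni: "i \<notin> fst ` F"
    have "\<exists>r. (i, r) \<in> B \<and> r \<notin> snd ` F"
      using ext[OF i]
    proof
      assume le: "card K \<le> card (column B i)"
      have "card (snd ` F) \<le> card (fst ` F)"
        using card_image_le[OF fin, of snd] card_image[OF inj] by simp
      also have "\<dots> < card K"
        using sub i ni assms(2) by (intro psubset_card_mono) auto
      finally have "\<not> column B i \<subseteq> snd ` F"
        using le card_mono[of "snd ` F" "column B i"] fin by fastforce
      then show ?thesis by (auto simp: column_def)
    next
      assume "\<exists>r. (i, r) \<in> B \<and> (\<forall>j. (j, r) \<in> B \<longrightarrow> j = i)"
      then obtain r where r: "(i, r) \<in> B" "\<And>j. (j, r) \<in> B \<Longrightarrow> j = i" by blast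
      have "r \<notin> snd ` F"
      proof
        assume "r \<in> snd ` F"
        then obtain j where "(j, r) \<in> F" by force
        then show False using r(2) FB ni by force
      qed
      with r(1) show ?thesis by blast
    qed
    then obtain r where r: "(i, r) \<in> B" "r \<notin> snd ` F" by blast
    have "non_attacking (insert (i, r) F)"
      using na ni r(2) unfolding non_attacking_def by force
    then have "insert (i, r) F = F" using mx[of "insert (i, r) F"] FB r(1) by blast
    then show False using ni by force
  qed
  then have "fst ` F = K" using sub by blast
  then show ?thesis using card_image[OF inj] by simp
qed

text \<open>The shedding rule in terms of boards: the column condition supplies purity, so only the
  two smaller boards have to be treated.\<close>

lemma shed_rook:
  assumes "finite B" "finite K" "fst ` B \<subseteq> K"
    and "\<And>i. i \<in> K \<Longrightarrow> card K \<le> card (column B i) \<or>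
           (\<exists>r. (i, r) \<in> B \<and> (\<forall>j. (j, r) \<in> B \<longrightarrow> j = i))"
    and "x \<in> B"
    and "vertex_decomposable (rook_complex (B - {x}))"
    and "vertex_decomposable (rook_complex (strike B x))"
  shows "vertex_decomposable (rook_complex B)"
proof (rule vertex_decomposable.shed[where x = x])
  show "pure_complex (rook_complex B)"
    using card_facet_rook[OF assms(1-4)] by (simp add: pure_complex_def face_dim_def)
  show "{x} \<in> rook_complex B"
    using assms(5) by (simp add: rook_complex_def non_attacking_def)
qed (use assms in \<open>simp_all add: deletion_rook link_rook simplicial_complex_rook\<close>)

section \<open>The order of shedding\<close>

text \<open>The stage in which row \<open>r\<close> contains only \<open>(c, r)\<close>. This square
  keeps the complex pure however short column \<open>c\<close> becomes, so the other squares of the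
  column can be shed one by one.\<close>

lemma vertex_decomposable_rook_private_square:
  assumes IH: "\<And>B'. finite B' \<Longrightarrow> fst ` B' \<subseteq> K - {c} \<Longrightarrow>
      (\<And>i. i \<in> K - {c} \<Longrightarrow> 2 * card (K - {c}) \<le> Suc (card (column B' i))) \<Longrightarrow>
      vertex_decomposable (rook_complex B')"
    and "finite K" "c \<in> K" "finite B" "fst ` B \<subseteq> K"
    and "(c, r) \<in> B" "\<And>j. (j, r) \<in> B \<Longrightarrow> j = c"
    and "\<And>i. i \<in> K - {c} \<Longrightarrow> 2 * card K \<le> card (column B i) + 2"
  shows "vertex_decomposable (rook_complex B)"
  using assms(4-)
proof (induction "card B" arbitrary: B rule: less_induct)
  case less
  note fin = less.prems(1) and sub = less.prems(2) and cr = less.prems(3)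
    and priv = less.prems(4) and big = less.prems(5)
  have cardK: "card K = Suc (card (K - {c}))"
    using assms(2,3) by (rule card.remove)
  have ext: "card K \<le> card (column B i) \<or> (\<exists>r. (i, r) \<in> B \<and> (\<forall>j. (j, r) \<in> B \<longrightarrow> j = i))"
    if "i \<in> K" for i
  proof (cases "i = c")
    case True
    then show ?thesis using cr priv by blast
  next
    case False
    with that have "i \<in> K - {c}" by simp
    \<comment> \<open>Both \<open>i\<close> and \<open>c\<close> lie in \<open>K\<close>, so
      \<open>card K \<ge> 2\<close> and hence \<open>2 * card K - 2 \<ge> card K\<close>.\<close>
    then have "card (K - {c}) > 0" using assms(2) card_gt_0_iff by blast
    then show ?thesis using big[OF \<open>i \<in> K - {c}\<close>] cardK by linarith
  qed
  \<comment> \<open>A link at any square of column \<open>c\<close> costs every other column at most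
    one square, while the loss of column \<open>c\<close> lowers \<open>2 * card K\<close> by
    two.\<close>
  have strike: "vertex_decomposable (rook_complex (strike B (c, s)))" for s
  proof (rule IH)
    show "fst ` strike B (c, s) \<subseteq> K - {c}" using sub by (auto simp: strike_def)
    show "2 * card (K - {c}) \<le> Suc (card (column (strike B (c, s)) i))" if "i \<in> K - {c}" for i
      using big[OF that] cardK card_Diff_singleton_ge[of "column B i" s] that
      by (simp add: column_strike)
  qed (simp add: fin finite_strike)
  show ?case
  proof (cases "column B c = {r}")
    case True
    \<comment> \<open>Here \<open>(c, r)\<close> is alone in its row and its column, so deletion and
      link are the same board on the columns \<open>K - {c}\<close>.\<close>
    have "vertex_decomposable (rook_complex (B - {(c, r)}))"
    proof (rule IH)
      show "fst ` (B - {(c, r)}) \<subseteq> K - {c}" using sub True by (force simp: column_def)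
      show "2 * card (K - {c}) \<le> Suc (card (column (B - {(c, r)}) i))" if "i \<in> K - {c}" for i
        using big[OF that] cardK that by (simp add: column_remove)
    qed (simp add: fin)
    with strike show ?thesis by (intro shed_rook[OF fin assms(2) sub ext cr])
  next
    case False
    then obtain s where s: "(c, s) \<in> B" "s \<noteq> r" using cr by (auto simp: column_def)
    have "vertex_decomposable (rook_complex (B - {(c, s)}))"
    proof (rule less.hyps)
      show "card (B - {(c, s)}) < card B" using fin s(1) by (rule card_Diff1_less)
      show "2 * card K \<le> card (column (B - {(c, s)}) i) + 2" if "i \<in> K - {c}" for i
        using big[OF that] that by (simp add: column_remove)
      show "j = c" if "(j, r) \<in> B - {(c, s)}" for j
        using priv that by blast
    qed (use fin sub cr s in auto)
    with strike show ?thesis by (intro shed_rook[OF fin assms(2) sub ext s(1)])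
  qed
qed

text \<open>The stage that empties row \<open>r\<close> except for \<open>(c, r)\<close>. The bound
  on the large columns discounts row \<open>r\<close>, so it is unaffected by shedding squares
  there. The induction hypothesis must allow any \<open>k\<close> as the lost column and an
  exceptional column \<open>d\<close>, because the link at \<open>(k, r)\<close> still contains the
  small column \<open>c\<close>.\<close>

lemma vertex_decomposable_rook_clear_row:
  assumes IH: "\<And>k d B'. k \<in> K \<Longrightarrow> finite B' \<Longrightarrow> fst ` B' \<subseteq> K - {k} \<Longrightarrow>
      (\<And>i. i \<in> K - {k} \<Longrightarrow> card (K - {k}) \<le> card (column B' i)) \<Longrightarrow>
      (\<And>i. i \<in> K - {k} \<Longrightarrow> i \<noteq> d \<Longrightarrow> 2 * card (K - {k}) \<le> Suc (card (column B' i))) \<Longrightarrow>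
      vertex_decomposable (rook_complex B')"
    and "finite K" "c \<in> K" "finite B" "fst ` B \<subseteq> K"
    and "(c, r) \<in> B" "card K \<le> card (column B c)"
    and "\<And>i. i \<in> K - {c} \<Longrightarrow> 2 * card K \<le> card (column B i - {r}) + 2"
  shows "vertex_decomposable (rook_complex B)"
  using assms(4-)
proof (induction "card B" arbitrary: B rule: less_induct)
  case less
  note fin = less.prems(1) and sub = less.prems(2) and cr = less.prems(3)
    and colc = less.prems(4) and big = less.prems(5)
  have cardK: "card K = Suc (card (K - {k}))" if "k \<in> K" for k
    using assms(2) that by (rule card.remove)
  have big': "2 * card K \<le> card (column B i) + 2" if "i \<in> K - {c}" for i
    using big[OF that] card_mono[of "column B i" "column B i - {r}"] finite_column[OF fin, of i]
    by fastforce
  have two: "2 \<le> card K" if "i \<in> K - {c}" for i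
  proof -
    have "card (K - {c}) > 0" using that assms(2) card_gt_0_iff by blast
    then show ?thesis using cardK[OF assms(3)] by linarith
  qed
  \<comment> \<open>The first alternative holds throughout: by \<open>colc\<close> for
    \<open>c\<close>, and otherwise because \<open>card K \<ge> 2\<close>.\<close>
  have ext: "card K \<le> card (column B i) \<or> (\<exists>r. (i, r) \<in> B \<and> (\<forall>j. (j, r) \<in> B \<longrightarrow> j = i))"
    if "i \<in> K" for i
    using that colc big'[of i] two[of i] by (cases "i = c") fastforce+
  show ?case
  proof (cases "\<exists>j. (j, r) \<in> B \<and> j \<noteq> c")
    case False
    show ?thesis
    proof (rule vertex_decomposable_rook_private_square[OF _ assms(2,3) fin sub cr _ big'])
      fix B'
      assume B': "finite B'" "fst ` B' \<subseteq> K - {c}"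
        "\<And>i. i \<in> K - {c} \<Longrightarrow> 2 * card (K - {c}) \<le> Suc (card (column B' i))"
      show "vertex_decomposable (rook_complex B')"
      proof (rule IH[OF assms(3) B'(1,2)])
        show "card (K - {c}) \<le> card (column B' i)" if "i \<in> K - {c}" for i
          using B'(3)[OF that] two[OF that] cardK[OF assms(3)] by linarith
      qed (use B'(3) in blast)
    qed (use False in blast)
  next
    case True
    then obtain k where k: "(k, r) \<in> B" "k \<noteq> c" by blast
    then have kK: "k \<in> K" using sub by force
    have "vertex_decomposable (rook_complex (B - {(k, r)}))"
    proof (rule less.hyps)
      show "card (B - {(k, r)}) < card B" using fin k(1) by (rule card_Diff1_less)
      show "2 * card K \<le> card (column (B - {(k, r)}) i - {r}) + 2" if "i \<in> K - {c}" for i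
        using big[OF that] by (auto simp: column_remove)
      show "card K \<le> card (column (B - {(k, r)}) c)"
        using colc k by (simp add: column_remove)
    qed (use fin sub cr k in auto)
    moreover have "vertex_decomposable (rook_complex (strike B (k, r)))"
    \<comment> \<open>The exceptional column is now \<open>c\<close>: it loses one square, and the
      required number drops by one with the loss of column \<open>k\<close>. The other columns lose
      at most their square in row \<open>r\<close>, which \<open>big\<close> has already
      discounted.\<close>
    proof (rule IH[OF kK])
      show "fst ` strike B (k, r) \<subseteq> K - {k}" using sub by (auto simp: strike_def)
      show large: "2 * card (K - {k}) \<le> Suc (card (column (strike B (k, r)) i))"
        if "i \<in> K - {k}" "i \<noteq> c" for i
        using big[of i] that cardK[OF kK] by (simp add: column_strike)
      show "card (K - {k}) \<le> card (column (strike B (k, r)) i)" if "i \<in> K - {k}" for i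
      proof (cases "i = c")
        case True
        then show ?thesis
          using colc card_Diff_singleton_ge[of "column B c" r] cardK[OF kK] k(2)
          by (simp add: column_strike)
      next
        case False
        then show ?thesis using large[OF that False] two[of i] cardK[OF kK] that by simp
      qed
    qed (simp add: fin finite_strike)
    ultimately show ?thesis by (intro shed_rook[OF fin assms(2) sub ext k(1)])
  qed
qed

text \<open>The bound \<open>2 * card K - 1\<close> reproduces itself: a large column gives up at
  most one square in row \<open>r\<close> and one more in a link along column \<open>c\<close>,
  while one column fewer lowers the bound by two. The exception \<open>d\<close> may lie outside
  \<open>K\<close>, which covers boards without a small column.\<close>

theorem vertex_decomposable_rook_if_large_columns:
  assumes "finite K" "finite B" "fst ` B \<subseteq> K"
    and "\<And>i. i \<in> K \<Longrightarrow> card K \<le> card (column B i)"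
    and "\<And>i. i \<in> K \<Longrightarrow> i \<noteq> d \<Longrightarrow> 2 * card K \<le> Suc (card (column B i))"
  shows "vertex_decomposable (rook_complex B)"
  using assms
proof (induction "card K" arbitrary: K B d rule: less_induct)
  case less
  show ?case
  proof (cases "K = {}")
    case True
    then have "rook_complex B = Pow {}"
      using less.prems(3) by (auto simp: rook_complex_def non_attacking_def)
    then show ?thesis using vertex_decomposable.simplex[of "{}"] by simp
  next
    case False
    \<comment> \<open>If \<open>d\<close> is outside \<open>K\<close>, all columns are large and any
      of them can play the small one. In both cases a column of \<open>K\<close> other than
      \<open>c\<close> differs from \<open>d\<close>.\<close>
    define c where "c = (if d \<in> K then d else SOME i. i \<in> K)"
    have c: "c \<in> K" using False by (auto simp: c_def some_in_eq)
    have "0 < card K" using less.prems(1) False by (simp add: card_gt_0_iff)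
    with less.prems(4)[OF c] have "column B c \<noteq> {}" by auto
    then obtain r where r: "(c, r) \<in> B" by (auto simp: column_def)
    show ?thesis
    proof (rule vertex_decomposable_rook_clear_row[OF _ less.prems(1) c less.prems(2,3) r])
      show "card K \<le> card (column B c)" using less.prems(4)[OF c] .
      show "2 * card K \<le> card (column B i - {r}) + 2" if "i \<in> K - {c}" for i
      proof -
        have "i \<in> K" "i \<noteq> d" using that by (auto simp: c_def)
        from less.prems(5)[OF this] show ?thesis
          using card_Diff_singleton_ge[of "column B i" r] by linarith
      qed
      fix k d B'
      assume k: "k \<in> K" and B': "finite B'" "fst ` B' \<subseteq> K - {k}"
        "\<And>i. i \<in> K - {k} \<Longrightarrow> card (K - {k}) \<le> card (column B' i)"
        "\<And>i. i \<in> K - {k} \<Longrightarrow> i \<noteq> d \<Longrightarrow> 2 * card (K - {k}) \<le> Suc (card (column B' i))"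
      show "vertex_decomposable (rook_complex B')"
        by (rule less.hyps[OF card_Diff1_less[OF less.prems(1) k] _ B'])
          (simp add: less.prems(1))
    qed
  qed
qed

section \<open>Column sizes of the triangular board\<close>

lemma triangular_rows_Suc:
  "triangular_rows (Suc n) a = triangular_rows n a @ replicate (a (Suc n)) (Suc n)"
  by (simp add: triangular_rows_def)

lemma set_triangular_rows: "set (triangular_rows n a) \<subseteq> {1..n}"
  by (auto simp: triangular_rows_def)

text \<open>A row meets column \<open>i\<close> exactly when its length is at least
  \<open>i\<close>. Column 0 is excluded: it is empty, although every row length is at least
  0.\<close>

lemma card_column_triangular_board:
  assumes "1 \<le> i"
  shows "card (column (triangular_board n a) i) =
         length (filter (\<lambda>l. i \<le> l) (triangular_rows n a))"
proof -
  let ?rows = "triangular_rows n a"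
  have "column (triangular_board n a) i = Suc ` {j. j < length ?rows \<and> i \<le> ?rows ! j}"
  proof (rule set_eqI)
    fix j
    show "j \<in> column (triangular_board n a) i \<longleftrightarrow>
          j \<in> Suc ` {j. j < length ?rows \<and> i \<le> ?rows ! j}"
      using assms by (cases j) (auto simp: column_def triangular_board_def)
  qed
  then show ?thesis
    by (simp add: card_image length_filter_conv_card)
qed

lemma triangular_board_subset:
  "triangular_board n a \<subseteq> {1..n} \<times> {1..length (triangular_rows n a)}"
proof (rule subsetI, clarify)
  fix i j
  assume "(i, j) \<in> triangular_board n a"
  then have ij: "1 \<le> j" "j \<le> length (triangular_rows n a)" "1 \<le> i"
    "i \<le> triangular_rows n a ! (j - 1)"
    by (simp_all add: triangular_board_def)
  have "triangular_rows n a ! (j - 1) \<in> set (triangular_rows n a)"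
    by (rule nth_mem) (use ij in linarith)
  with set_triangular_rows[of n a] have "triangular_rows n a ! (j - 1) \<le> n" by force
  with ij show "i \<in> {1..n} \<and> j \<in> {1..length (triangular_rows n a)}" by simp
qed

theorem theorem3p1:
  fixes n :: nat and a :: "nat \<Rightarrow> nat"
  assumes "n \<ge> 1"
    and "\<And>i. 1 \<le> i \<Longrightarrow> i \<le> n \<Longrightarrow> a i \<ge> i"
  shows "vertex_decomposable (rook_complex (triangular_board n a))"
proof (rule vertex_decomposable_rook_if_large_columns[where K = "{1..n}" and d = n])
  show "finite (triangular_board n a)"
    using triangular_board_subset by (rule finite_subset) simp
  show "fst ` triangular_board n a \<subseteq> {1..n}"
    by (rule order_trans[OF image_mono[OF triangular_board_subset]]) auto
  obtain m where m: "n = Suc m" using assms(1) by (cases n) auto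
  \<comment> \<open>The \<open>a n \<ge> n\<close> rows of length \<open>n\<close> meet every
    column.\<close>
  show "card {1..n} \<le> card (column (triangular_board n a) i)" if "i \<in> {1..n}" for i
    using that assms(2)[of n] m
    by (simp add: card_column_triangular_board triangular_rows_Suc)
  show "2 * card {1..n} \<le> Suc (card (column (triangular_board n a) i))"
    if i: "i \<in> {1..n}" "i \<noteq> n" for i
  proof -
    \<comment> \<open>A column before the last exists, so \<open>n \<ge> 2\<close>. Unfolding the
      rows twice exposes the blocks of lengths \<open>n\<close> and \<open>n - 1\<close>, both of
      which meet column \<open>i\<close>.\<close>
    obtain k where "m = Suc k" using i m by (cases m) auto
    then show ?thesis
      using i assms(2)[of n] assms(2)[of m] m
      by (simp add: card_column_triangular_board triangular_rows_Suc)
  qed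
qed simp

end
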